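(* Let $\delta\in(0,1/2)$ be fixed, and let $Y$ and $L$ be as defined in the context. Suppose $(p_m,q_m)$, $m=1,2,\dots$, is a sequence of points in $\mathbb{R}^2$ and $\beta\in\mathbb{R}$ are such that for all $m$ $$Y(p_m,q_m)=0,\qquad q_m\neq 0,\qquad \left|\frac{p_m}{q_m}\right|<1-\delta,$$ and $|q_m|\to\infty$, $\lim_{m\to\infty}\frac{p_m}{q_m}=\beta$. Then $$\frac{d^L}{dz^L}\left(\frac{1}{(1+z^2)^{3/2}}\right)\bigg|_{z=\beta}=0.$$
   Context: Let $M\ge1$, let $0<x_1<x_2<\cdots<x_M$ be real numbers and let $a_1,\dots,a_M$ be real numbers, not all zero. For $(x,y)\in\mathbb{R}^2\setminus\{(x_1,0),\dots,(x_M,0)\}$ let $$Y(x,y)=\sum_{j=1}^M\frac{a_jy}{((x-x_j)^2+y^2)^{3/2}}.$$ Let $\mu_k=\sum_{j=1}^M a_jx_j^k$ for $k=0,1,\dots$. The integer $L$, $0\le L\le M-1$, is the unique integer such that $\mu_k=0$ for $k=0,1,\dots,L-1$ and $\mu_L\neq0$ (it exists by the non-vanishing of Vandermonde determinants). The $0$th derivative of a function is the function itself. *)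

theory Defs
  imports "HOL-Analysis.Analysis"
begin

text \<open>
  The data \<open>x\<^sub>1, \<dots>, x\<^sub>M\<close> and \<open>a\<^sub>1, \<dots>, a\<^sub>M\<close> are functions \<open>x a :: nat \<Rightarrow> real\<close> of which only
  the values at the indices \<open>1, \<dots>, M\<close> are used.
\<close>

text \<open>At the excluded points \<open>(x\<^sub>j, 0)\<close> this total function takes an irrelevant value.\<close>

definition Y :: "nat \<Rightarrow> (nat \<Rightarrow> real) \<Rightarrow> (nat \<Rightarrow> real) \<Rightarrow> real \<Rightarrow> real \<Rightarrow> real" where
  "Y M x a u v = (\<Sum>j=1..M. a j * v / ((u - x j)\<^sup>2 + v\<^sup>2) powr (3/2))"

definition moment :: "nat \<Rightarrow> (nat \<Rightarrow> real) \<Rightarrow> (nat \<Rightarrow> real) \<Rightarrow> nat \<Rightarrow> real" where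
  "moment M x a k = (\<Sum>j=1..M. a j * x j ^ k)"

definition moment_order :: "nat \<Rightarrow> (nat \<Rightarrow> real) \<Rightarrow> (nat \<Rightarrow> real) \<Rightarrow> nat" where
  "moment_order M x a =
     (THE L. L \<le> M - 1 \<and> (\<forall>k<L. moment M x a k = 0) \<and> moment M x a L \<noteq> 0)"

text \<open>The description in \<open>moment_order\<close> is proper.\<close>

lemma moment_order_ex1:
  assumes "M \<ge> 1" and x: "strict_mono_on {1..M} x" and a: "\<exists>j\<in>{1..M}. a j \<noteq> 0"
  shows "\<exists>!L. L \<le> M - 1 \<and> (\<forall>k<L. moment M x a k = 0) \<and> moment M x a L \<noteq> 0"
proof -
  have ex: "\<exists>k<M. moment M x a k \<noteq> 0"
  proof (rule ccontr)
    assume "\<not> ?thesis"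
    hence zero: "moment M x a k = 0" if "k < M" for k using that by blast
    obtain j where j: "j \<in> {1..M}" "a j \<noteq> 0" using a by blast
    define P where "P = (\<Prod>i\<in>{1..M}-{j}. [:- x i, 1:])"
    have "degree P \<le> (\<Sum>i\<in>{1..M}-{j}. degree [:- x i, 1:])"
      unfolding P_def using degree_prod_sum_le[of "{1..M}-{j}" "\<lambda>i. [:- x i, 1:]"] by (simp add: o_def)
    also have "\<dots> = M - 1" using j by simp
    finally have deg: "k < M" if "k \<le> degree P" for k using that \<open>M \<ge> 1\<close> by linarith
    have "(\<Sum>i=1..M. a i * poly P (x i)) = (\<Sum>i=1..M. \<Sum>k\<le>degree P. coeff P k * (a i * x i ^ k))"
      by (simp add: poly_altdef sum_distrib_left mult_ac)
    also have "\<dots> = (\<Sum>k\<le>degree P. coeff P k * moment M x a k)"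
      by (subst sum.swap) (simp add: moment_def sum_distrib_left)
    also have "\<dots> = 0" using zero deg by (intro sum.neutral) auto
    finally have "(\<Sum>i=1..M. a i * poly P (x i)) = 0" .
    moreover have "(\<Sum>i=1..M. a i * poly P (x i)) = a j * poly P (x j)"
    proof -
      have "poly P (x i) = 0" if "i \<in> {1..M} - {j}" for i
        unfolding P_def poly_prod using that by (intro prod_zero bexI[of _ i]) auto
      thus ?thesis using j by (subst sum.remove[of _ j]) auto
    qed
    moreover have "inj_on x {1..M}" using x by (rule strict_mono_on_imp_inj_on)
    hence "poly P (x j) \<noteq> 0" using j by (auto simp: P_def poly_prod dest: inj_onD)
    ultimately show False using j by simp
  qed
  then obtain n where n: "n < M" "moment M x a n \<noteq> 0" by blast
  define L where "L = (LEAST k. moment M x a k \<noteq> 0)"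
  have L: "moment M x a L \<noteq> 0"
    unfolding L_def using n(2) by (rule LeastI)
  have less: "moment M x a k = 0" if "k < L" for k
    using not_less_Least that unfolding L_def by blast
  have "L \<le> n"
    unfolding L_def using n(2) by (rule Least_le)
  show ?thesis
  proof (rule ex1I[of _ L])
    show "L \<le> M - 1 \<and> (\<forall>k<L. moment M x a k = 0) \<and> moment M x a L \<noteq> 0"
      using L less \<open>L \<le> n\<close> n(1) by auto
  next
    fix K assume "K \<le> M - 1 \<and> (\<forall>k<K. moment M x a k = 0) \<and> moment M x a K \<noteq> 0"
    thus "K = L" using L less by (cases K L rule: linorder_cases) auto
  qed
qed

end

theory Submission
  imports Defs
begin

text \<open>
  Write \<open>f z = (1 + z\<^sup>2) powr (-3/2)\<close>. For \<open>v \<noteq> 0\<close>, taking \<open>v\<^sup>2\<close> out of every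
  denominator shows that \<open>Y(u, v)\<close> is, up to the nonzero factor \<open>v / \<bar>v\<bar>\<^sup>3\<close>, the sum
  \<open>\<Sum>\<^sub>j a\<^sub>j f(t - x\<^sub>j h)\<close> with \<open>t = u / v\<close> and \<open>h = 1 / v\<close>
  (\<open>Y_eq_weighted_sum_profile\<close>). Expanding every summand around \<open>t\<close> to order \<open>L\<close> with
  Lagrange remainder, the coefficient of \<open>h\<^sup>k\<close> is a multiple of the moment \<open>\<mu>\<^sub>k\<close>, so for
  \<open>k < L\<close> it vanishes and only the remainders survive
  (\<open>weighted_sum_Taylor_vanishing_moments\<close>). At a zero of \<open>Y\<close> one may divide by \<open>h\<^sup>L\<close>, which
  leaves \<open>\<Sum>\<^sub>j a\<^sub>j x\<^sub>j\<^sup>L f\<^sup>(\<^sup>L\<^sup>)(\<xi>\<^sub>j) = 0\<close> with \<open>\<xi>\<^sub>j\<close> within \<open>\<bar>x\<^sub>j h\<bar>\<close> of \<open>t\<close>. Along the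
  given sequence \<open>h \<longlonglongrightarrow> 0\<close> and \<open>t \<longlonglongrightarrow> \<beta>\<close>, hence \<open>\<xi>\<^sub>j \<longlonglongrightarrow> \<beta>\<close> for every \<open>j\<close>, and
  the continuity of \<open>f\<^sup>(\<^sup>L\<^sup>)\<close> gives \<open>\<mu>\<^sub>L f\<^sup>(\<^sup>L\<^sup>)(\<beta>) = 0\<close>, where \<open>\<mu>\<^sub>L \<noteq> 0\<close>.
\<close>

abbreviation profile :: "real \<Rightarrow> real" where
  "profile \<equiv> \<lambda>z. 1 / (1 + z\<^sup>2) powr (3/2)"

text \<open>The class of functions \<open>P(z) (1 + z\<^sup>2) powr s\<close> with polynomial \<open>P\<close> is closed under
  differentiation and contains the profile, as \<open>P = 1\<close>, \<open>s = -3/2\<close>. Hence the profile is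
  smooth.\<close>

lemma poly_powr_has_field_derivative:
  fixes P :: "real poly"
  shows "((\<lambda>z. poly P z * (1 + z\<^sup>2) powr s) has_field_derivative
      poly ([:1, 0, 1:] * pderiv P + [:0, 2 * s:] * P) z * (1 + z\<^sup>2) powr (s - 1)) (at z)"
proof -
  have pos: "1 + z\<^sup>2 > 0" by (simp add: add_pos_nonneg)
  have "((\<lambda>z. 1 + z\<^sup>2) has_field_derivative 2 * z) (at z)"
    by (auto intro!: derivative_eq_intros)
  from DERIV_mult[OF poly_DERIV[of P] DERIV_fun_powr[OF this pos, of s]]
  have "((\<lambda>z. poly P z * (1 + z\<^sup>2) powr s) has_field_derivative
      poly (pderiv P) z * (1 + z\<^sup>2) powr s + s * (1 + z\<^sup>2) powr (s - 1) * (2 * z) * poly P z) (at z)"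
    by simp
  moreover have "(1 + z\<^sup>2) powr s = (1 + z\<^sup>2) * (1 + z\<^sup>2) powr (s - 1)"
    using pos by (simp add: powr_diff)
  then have "poly (pderiv P) z * (1 + z\<^sup>2) powr s + s * (1 + z\<^sup>2) powr (s - 1) * (2 * z) * poly P z =
      poly ([:1, 0, 1:] * pderiv P + [:0, 2 * s:] * P) z * (1 + z\<^sup>2) powr (s - 1)"
    by (simp add: ring_distribs power2_eq_square mult_ac)
  ultimately show ?thesis
    by simp
qed

lemma iterated_deriv_profile:
  "\<exists>P. (deriv ^^ k) profile = (\<lambda>z. poly P z * (1 + z\<^sup>2) powr (- (3/2) - real k))"
proof (induction k)
  case 0
  show ?case
    by (rule exI[of _ 1]) (simp add: powr_minus_divide)
next
  case (Suc k)
  then obtain P where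
    P: "(deriv ^^ k) profile = (\<lambda>z. poly P z * (1 + z\<^sup>2) powr (- (3/2) - real k))"
    by blast
  have exponent: "- (3/2) - real (Suc k) = - (3/2) - real k - 1" by simp
  show ?case
    unfolding funpow.simps o_apply P exponent
    by (rule exI, rule ext, rule DERIV_imp_deriv, rule poly_powr_has_field_derivative)
qed

lemma iterated_deriv_profile_has_field_derivative:
  "((deriv ^^ k) profile has_field_derivative (deriv ^^ Suc k) profile z) (at z)"
proof -
  obtain P where P: "(deriv ^^ k) profile = (\<lambda>z. poly P z * (1 + z\<^sup>2) powr (- (3/2) - real k))"
    using iterated_deriv_profile by blast
  have "(deriv ^^ k) profile field_differentiable at z"
    unfolding P field_differentiable_def using poly_powr_has_field_derivative by blast
  then show ?thesis
    by (simp add: field_differentiable_derivI)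
qed

lemma Taylor_Lagrange_at:
  fixes diff :: "nat \<Rightarrow> real \<Rightarrow> real"
  assumes "\<And>k z. (diff k has_field_derivative diff (Suc k) z) (at z)"
  shows "\<exists>\<xi>. \<bar>\<xi> - t\<bar> \<le> \<bar>s\<bar> \<and>
    diff 0 (t + s) = (\<Sum>k<n. diff k t / fact k * s ^ k) + diff n \<xi> / fact n * s ^ n"
proof -
  have "((\<lambda>z. diff k (t + z)) has_field_derivative diff (Suc k) (t + z)) (at z)" for k z
    using assms[of k "z + t"] by (simp only: DERIV_shift add.commute[of t])
  then obtain \<eta> where "\<bar>\<eta>\<bar> \<le> \<bar>s\<bar>"
    "diff 0 (t + s) = (\<Sum>k<n. diff k (t + 0) / fact k * s ^ k) + diff n (t + \<eta>) / fact n * s ^ n"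
    using Maclaurin_all_le[of "\<lambda>k z. diff k (t + z)" "\<lambda>z. diff 0 (t + z)" s n] by auto
  then show ?thesis
    by (intro exI[of _ "t + \<eta>"]) simp
qed

text \<open>Summing the expansions of \<open>diff 0 (t - x\<^sub>j h)\<close> with weights \<open>a\<^sub>j\<close> makes the \<open>k\<close>-th term
  proportional to the \<open>k\<close>-th moment. Lagrange's form of the remainder puts all that survives into
  values of the \<open>n\<close>-th derivative, so its continuity is what a passage to the limit
  \<open>h \<longlonglongrightarrow> 0\<close> rests on.\<close>

lemma weighted_sum_Taylor_vanishing_moments:
  fixes diff :: "nat \<Rightarrow> real \<Rightarrow> real"
  assumes diff: "\<And>k z. (diff k has_field_derivative diff (Suc k) z) (at z)"
    and moments: "\<And>k. k < n \<Longrightarrow> moment M x a k = 0"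
  shows "\<exists>\<xi>. (\<forall>j. \<bar>\<xi> j - t\<bar> \<le> \<bar>x j * h\<bar>) \<and>
    (\<Sum>j=1..M. a j * diff 0 (t - x j * h)) =
      (- h) ^ n / fact n * (\<Sum>j=1..M. a j * x j ^ n * diff n (\<xi> j))"
proof -
  have "\<forall>j. \<exists>\<xi>. \<bar>\<xi> - t\<bar> \<le> \<bar>x j * h\<bar> \<and> diff 0 (t - x j * h) =
      (\<Sum>k<n. diff k t / fact k * (x j * (- h)) ^ k) + diff n \<xi> / fact n * (x j * (- h)) ^ n"
  proof
    fix j
    show "\<exists>\<xi>. \<bar>\<xi> - t\<bar> \<le> \<bar>x j * h\<bar> \<and> diff 0 (t - x j * h) =
      (\<Sum>k<n. diff k t / fact k * (x j * (- h)) ^ k) + diff n \<xi> / fact n * (x j * (- h)) ^ n"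
      using Taylor_Lagrange_at[of diff t "x j * (- h)" n, OF diff] by simp
  qed
  from choice[OF this] obtain \<xi> where \<xi>: "\<And>j. \<bar>\<xi> j - t\<bar> \<le> \<bar>x j * h\<bar>"
    and expansion: "\<And>j. diff 0 (t - x j * h) =
      (\<Sum>k<n. diff k t / fact k * (x j * (- h)) ^ k) + diff n (\<xi> j) / fact n * (x j * (- h)) ^ n"
    by blast
  have "(\<Sum>j=1..M. \<Sum>k<n. a j * (diff k t / fact k * (x j * (- h)) ^ k)) =
      (\<Sum>k<n. diff k t / fact k * (- h) ^ k * moment M x a k)"
    unfolding moment_def sum_distrib_left power_mult_distrib
    by (subst sum.swap) (intro sum.cong refl, simp only: mult_ac)
  also have "\<dots> = 0"
    by (intro sum.neutral) (simp add: moments)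
  finally have lower: "(\<Sum>j=1..M. \<Sum>k<n. a j * (diff k t / fact k * (x j * (- h)) ^ k)) = 0" .
  have "(\<Sum>j=1..M. a j * diff 0 (t - x j * h)) =
      (\<Sum>j=1..M. a j * (diff n (\<xi> j) / fact n * (x j * (- h)) ^ n))"
    unfolding expansion ring_distribs sum.distrib sum_distrib_left lower by simp
  also have "\<dots> = (- h) ^ n / fact n * (\<Sum>j=1..M. a j * x j ^ n * diff n (\<xi> j))"
    unfolding sum_distrib_left power_mult_distrib by (intro sum.cong) simp_all
  finally show ?thesis
    using \<xi> by blast
qed

lemma Y_eq_weighted_sum_profile:
  assumes "v \<noteq> 0"
  shows "Y M x a u v = v / (v\<^sup>2) powr (3/2) * (\<Sum>j=1..M. a j * profile (u / v - x j * (1 / v)))"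
proof -
  have "((u - x j)\<^sup>2 + v\<^sup>2) powr (3/2) =
      (v\<^sup>2) powr (3/2) * (1 + (u / v - x j * (1 / v))\<^sup>2) powr (3/2)" for j
  proof -
    have "(u - x j)\<^sup>2 + v\<^sup>2 = v\<^sup>2 * (1 + (u / v - x j * (1 / v))\<^sup>2)"
      using assms by (simp add: field_simps power2_eq_square)
    then show ?thesis
      by (simp add: powr_mult)
  qed
  then show ?thesis
    by (simp add: Y_def sum_distrib_left mult_ac)
qed

theorem proposition2p5:
  fixes M :: nat and x a p q :: "nat \<Rightarrow> real" and \<delta> \<beta> :: real
  assumes "M \<ge> 1"
    and "0 < x 1" and "strict_mono_on {1..M} x"
    and "\<exists>j\<in>{1..M}. a j \<noteq> 0"
    and "0 < \<delta>" and "\<delta> < 1/2"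
    and "\<And>m. m \<ge> 1 \<Longrightarrow> Y M x a (p m) (q m) = 0"
    and "\<And>m. m \<ge> 1 \<Longrightarrow> q m \<noteq> 0"
    and "\<And>m. m \<ge> 1 \<Longrightarrow> \<bar>p m / q m\<bar> < 1 - \<delta>"
    and "filterlim (\<lambda>m. \<bar>q m\<bar>) at_top sequentially"
    and "(\<lambda>m. p m / q m) \<longlonglongrightarrow> \<beta>"
  shows "(deriv ^^ moment_order M x a) (\<lambda>z::real. 1 / (1 + z\<^sup>2) powr (3/2)) \<beta> = 0"
proof -
  define L where "L = moment_order M x a"
  define F where "F = (\<lambda>k. (deriv ^^ k) profile)"
  have L: "L \<le> M - 1 \<and> (\<forall>k<L. moment M x a k = 0) \<and> moment M x a L \<noteq> 0"
    unfolding L_def moment_order_def by (rule theI'[OF moment_order_ex1[OF assms(1,3,4)]])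
  have F0: "F 0 = profile" by (simp add: F_def)
  have F: "(F k has_field_derivative F (Suc k) z) (at z)" for k z
    unfolding F_def by (rule iterated_deriv_profile_has_field_derivative)
  have "\<forall>m. \<exists>\<xi>. (\<forall>j. \<bar>\<xi> j - p m / q m\<bar> \<le> \<bar>x j * (1 / q m)\<bar>) \<and>
      (\<Sum>j=1..M. a j * F 0 (p m / q m - x j * (1 / q m))) =
        (- (1 / q m)) ^ L / fact L * (\<Sum>j=1..M. a j * x j ^ L * F L (\<xi> j))"
    using L by (intro allI weighted_sum_Taylor_vanishing_moments F) simp
  from choice[OF this] obtain \<xi> where \<xi>: "\<And>m j. \<bar>\<xi> m j - p m / q m\<bar> \<le> \<bar>x j * (1 / q m)\<bar>"
    and sum_eq: "\<And>m. (\<Sum>j=1..M. a j * F 0 (p m / q m - x j * (1 / q m))) =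
        (- (1 / q m)) ^ L / fact L * (\<Sum>j=1..M. a j * x j ^ L * F L (\<xi> m j))"
    by blast
  have zero: "(\<Sum>j=1..M. a j * x j ^ L * F L (\<xi> m j)) = 0" if "m \<ge> 1" for m
  proof -
    have "q m \<noteq> 0" using assms(8) that .
    then have "(\<Sum>j=1..M. a j * F 0 (p m / q m - x j * (1 / q m))) = 0"
      using assms(7)[OF that] Y_eq_weighted_sum_profile[of "q m" M x a "p m"] by (simp add: F0)
    then show ?thesis
      using sum_eq[of m] \<open>q m \<noteq> 0\<close> by simp
  qed
  have "(\<lambda>m. 1 / q m) \<longlonglongrightarrow> 0"
    using tendsto_divide_0[OF tendsto_const, of q sequentially 1] assms(10)
    by (simp add: filterlim_at_infinity_conv_norm_at_top)
  then have radius: "(\<lambda>m. \<bar>x j * (1 / q m)\<bar>) \<longlonglongrightarrow> 0" for j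
    by (intro tendsto_rabs_zero tendsto_mult_right_zero)
  have "(\<lambda>m. \<xi> m j - p m / q m) \<longlonglongrightarrow> 0" for j
    by (rule tendsto_rabs_zero_cancel, rule tendsto_sandwich[OF _ _ tendsto_const radius[of j]])
      (use \<xi> in auto)
  from tendsto_add[OF this assms(11)] have "(\<lambda>m. \<xi> m j) \<longlonglongrightarrow> \<beta>" for j
    by simp
  moreover have "isCont (F L) \<beta>"
    using F by (rule DERIV_isCont)
  ultimately have "(\<lambda>m. \<Sum>j=1..M. a j * x j ^ L * F L (\<xi> m j))
      \<longlonglongrightarrow> (\<Sum>j=1..M. a j * x j ^ L * F L \<beta>)"
    by (intro tendsto_intros isCont_tendsto_compose[of \<beta> "F L"])
  moreover have "(\<lambda>m. \<Sum>j=1..M. a j * x j ^ L * F L (\<xi> m j)) \<longlonglongrightarrow> 0"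
    by (rule tendsto_eventually) (use zero in \<open>auto simp: eventually_sequentially\<close>)
  ultimately have "(\<Sum>j=1..M. a j * x j ^ L * F L \<beta>) = 0"
    by (rule LIMSEQ_unique)
  then have "moment M x a L * F L \<beta> = 0"
    by (simp add: moment_def sum_distrib_right)
  then show ?thesis
    using L by (simp add: F_def L_def)
qed

end
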